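(* For each $k$ let $\delta^k:=\left(\frac1\omega-\frac12\right)\min(\mathrm{diag}(\mathbf{D}^k))+\epsilon$ and let $\omega\in(0,2)$, $\epsilon\in[0,\infty)$ be chosen such that $\delta^k\in(0,\infty)$. Assume that $\nabla q$ is $L$-Lipschitz continuous. For the line-search algorithm described in the context: (i) For each $k$ there always exists a strictly positive constant $\alpha^k$ such that the descent condition $f(\mathbf{x}^k+\alpha^k\mathbf{d}^k)\le f(\mathbf{x}^k)+\alpha^k\tau\Delta^k$ is satisfied. (ii) The sequence $\{f(\mathbf{x}^k)\}_{k=0}^\infty$ is nonincreasing and the algorithm is globally convergent, i.e. for every starting point $\mathbf{x}^0\in\mathbb{R}^n$, every cluster point of $\{\mathbf{x}^k\}$ is a global minimizer of $f$.
   Context: Let $q:\mathbb{R}^n\to\mathbb{R}$ be convex and twice differentiable, $h:\mathbb{R}^n\to\mathbb{R}$ convex and separable ($h(\mathbf{x})=\sum_i h_i(\mathbf{x}_i)$), and $f=q+h$ bounded below. Triangle proximal operator: for a symmetric positive semidefinite matrix $\mathbf{A}$ with diagonal part $\mathbf{D}$ and strictly lower triangular part $\mathbf{L}$ (so $\mathbf{A}=\mathbf{L}+\mathbf{D}+\mathbf{L}^T$), and parameters $\omega\in(0,2)$, $\epsilon\in[0,\infty)$, set $\mathbf{B}=\mathbf{L}+\frac1\omega\mathbf{D}+\epsilon\mathbf{I}$ (with positive diagonal entries) and $\mathbf{C}=\mathbf{A}-\mathbf{B}=\mathbf{L}^T+\frac{\omega-1}{\omega}\mathbf{D}-\epsilon\mathbf{I}$.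 For a vector $\mathbf{b}$, $\mathcal{T}(\mathbf{x};\mathbf{A},\mathbf{b},h)$ is the unique $\mathbf{z}$ with $\mathbf{0}\in\mathbf{B}\mathbf{z}+\mathbf{C}\mathbf{x}+\mathbf{b}+\partial h(\mathbf{z})$. Algorithm: fix $\omega,\epsilon$ and line-search parameters $\eta\in(0,1)$, $\tau\in(0,1)$. Start at $\mathbf{x}^0$. For $k=0,1,2,\dots$: put $\mathbf{A}^k=\nabla^2q(\mathbf{x}^k)$, $\mathbf{b}^k=\nabla q(\mathbf{x}^k)-\nabla^2q(\mathbf{x}^k)\mathbf{x}^k$, $\mathbf{y}^k=\mathcal{T}(\mathbf{x}^k;\mathbf{A}^k,\mathbf{b}^k,h)$, $\mathbf{d}^k=\mathbf{y}^k-\mathbf{x}^k$, $\Delta^k=\langle\nabla q(\mathbf{x}^k),\mathbf{d}^k\rangle+h(\mathbf{x}^k+\mathbf{d}^k)-h(\mathbf{x}^k)$; let $\alpha^k$ be the largest element of $\{\eta^0,\eta^1,\eta^2,\dots\}$ with $f(\mathbf{x}^k+\alpha^k\mathbf{d}^k)\le f(\mathbf{x}^k)+\alpha^k\tau\Delta^k$; set $\mathbf{x}^{k+1}=\mathbf{x}^k+\alpha^k\mathbf{d}^k$. $\mathbf{D}^k$ denotes the diagonal part of $\mathbf{A}^k$, $\mathrm{diag}(\mathbf{D}^k)$ its vector of diagonal entries, and $\min(\cdot)$ the smallest entry.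
   Formalization: In (ii), global minimality is shown only for cluster points that are limits of a subsequence of x^k along which δ^k does not tend to 0; for ε=0 the unrestricted claim is false. The restriction is vacuous when ε>0 or δ^k is bounded away from 0. *)

theory Defs
  imports "HOL-Analysis.Analysis"
begin

(* The order on the index type (class linorder) fixes what "lower triangular" means. *)

definition diag_part :: "real ^ 'n::finite ^ 'n \<Rightarrow> real ^ 'n ^ 'n" where
  "diag_part A = (\<chi> i j. if i = j then A $ i $ j else 0)"

definition strict_lower_part ::
  "real ^ 'n::{finite,linorder} ^ 'n::_ \<Rightarrow> real ^ 'n::_ ^ 'n::_" where
  "strict_lower_part A = (\<chi> i j. if j < i then A $ i $ j else 0)"

definition split_B ::
  "real \<Rightarrow> real \<Rightarrow> real ^ 'n::{finite,linorder} ^ 'n::_ \<Rightarrow> real ^ 'n::_ ^ 'n::_" where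
  "split_B \<omega> \<epsilon> A = strict_lower_part A + (1 / \<omega>) *\<^sub>R diag_part A + \<epsilon> *\<^sub>R mat 1"

definition split_C ::
  "real \<Rightarrow> real \<Rightarrow> real ^ 'n::{finite,linorder} ^ 'n::_ \<Rightarrow> real ^ 'n::_ ^ 'n::_" where
  "split_C \<omega> \<epsilon> A = A - split_B \<omega> \<epsilon> A"

definition subdifferential :: "('a::real_inner \<Rightarrow> real) \<Rightarrow> 'a \<Rightarrow> 'a set" where
  "subdifferential h z = {g. \<forall>y. h z + g \<bullet> (y - z) \<le> h y}"

(* Unspecified if the inclusion does not have exactly one solution. *)
definition triangle_prox ::
  "real \<Rightarrow> real \<Rightarrow> real ^ 'n::{finite,linorder} \<Rightarrow> real ^ 'n::_ ^ 'n::_ \<Rightarrow> real ^ 'n::_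
    \<Rightarrow> (real ^ 'n::_ \<Rightarrow> real) \<Rightarrow> real ^ 'n::_" where
  "triangle_prox \<omega> \<epsilon> x A b h =
    (THE z. 0 \<in> (\<lambda>g. split_B \<omega> \<epsilon> A *v z + split_C \<omega> \<epsilon> A *v x + b + g) ` subdifferential h z)"

definition split_delta :: "real \<Rightarrow> real \<Rightarrow> real ^ 'n::finite ^ 'n \<Rightarrow> real" where
  "split_delta \<omega> \<epsilon> A = (1 / \<omega> - 1 / 2) * Min (range (\<lambda>i. diag_part A $ i $ i)) + \<epsilon>"

end

theory Submission
  imports Defs
begin

text \<open>
The triangular matrix \<open>B\<close> of the splitting is not symmetric, but its quadratic form is bounded
below by \<open>\<delta> (norm v)\<^sup>2\<close> (lemma \<open>split_B_strongly_monotone\<close>). The matrix being split is the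
Hessian of \<open>q\<close>, and the bound needs it symmetric and positive semidefinite; the symmetry is that
of second differences (\<open>hessian_symmetric\<close>), and semidefiniteness expresses that the gradient of
a convex function is monotone (\<open>convex_hessian_nonneg\<close>). Strong monotonicity makes the triangle proximal operator
well defined (\<open>strongly_monotone_inclusion_ex1\<close>), and in terms of the step \<open>d = y - x\<close> its
inclusion reads \<open>-B d - \<nabla>q(x) \<in> \<partial>h(y)\<close>.

Inserting \<open>x\<close> into this subgradient inequality at \<open>y\<close> gives \<open>\<Delta> \<le> -\<delta> (norm d)\<^sup>2\<close>. As the
gradient of \<open>q\<close> is \<open>L\<close>-Lipschitz, every step length \<open>a \<le> 1\<close> with
\<open>L a \<le> 2 (1 - \<tau>) \<delta>\<close> passes the descent test, so backtracking stops, at a length bounded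
below in terms of \<open>\<delta>\<close> (\<open>backtracking_step\<close>), and \<open>f\<close> does not increase along the iteration.

Since \<open>f\<close> is bounded below, the decreases \<open>\<alpha> \<tau> \<delta> (norm d)\<^sup>2\<close> tend to \<open>0\<close>. If \<open>\<delta>\<close> does not
tend to \<open>0\<close> along a subsequence converging to \<open>xs\<close>, it stays above some \<open>c > 0\<close> on a further
subsequence; there the step lengths are bounded below as well, whence \<open>d\<close> tends to \<open>0\<close>. Hessians
of \<open>q\<close> are bounded by \<open>L\<close>, so \<open>B d\<close> also tends to \<open>0\<close>, and the closed graph of the
subdifferential turns the inclusions into \<open>-\<nabla>q(xs) \<in> \<partial>h(xs)\<close>. For convex \<open>q\<close> and \<open>h\<close> this
is global optimality of \<open>xs\<close>.
\<close>

section \<open>Derivatives of convex functions and functions with Lipschitz gradient\<close>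

lemma directional_derivative_right:
  fixes f :: "'a::real_normed_vector \<Rightarrow> 'b::real_normed_vector"
  assumes "(f has_derivative f') (at x)"
  shows "((\<lambda>t. (1 / t) *\<^sub>R (f (x + t *\<^sub>R v) - f x)) \<longlongrightarrow> f' v) (at_right 0)"
proof -
  interpret bounded_linear f' using assms by (rule has_derivative_bounded_linear)
  have "((\<lambda>t. x + t *\<^sub>R v) has_derivative (\<lambda>t. t *\<^sub>R v)) (at 0 within {0<..})"
    by (auto intro!: derivative_eq_intros)
  from has_derivative_compose[OF this, of f f'] assms
  have "((\<lambda>t. f (x + t *\<^sub>R v)) has_derivative (\<lambda>t. t *\<^sub>R f' v)) (at 0 within {0<..})"
    by (simp add: scaleR)
  then have "((\<lambda>t. (1 / norm t) *\<^sub>R (f (x + t *\<^sub>R v) - (f x + t *\<^sub>R f' v))) \<longlongrightarrow> 0) (at_right 0)"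
    by (simp add: has_derivative_within)
  then have "((\<lambda>t. (1 / norm t) *\<^sub>R (f (x + t *\<^sub>R v) - (f x + t *\<^sub>R f' v)) + f' v) \<longlongrightarrow> 0 + f' v)
      (at_right 0)"
    by (intro tendsto_add tendsto_const)
  moreover have "\<forall>\<^sub>F t in at_right 0. (1 / norm t) *\<^sub>R (f (x + t *\<^sub>R v) - (f x + t *\<^sub>R f' v)) + f' v
      = (1 / t) *\<^sub>R (f (x + t *\<^sub>R v) - f x)"
    using eventually_at_right_less[of "0::real"]
    by eventually_elim (simp add: algebra_simps)
  ultimately show ?thesis
    by (auto dest: tendsto_cong)
qed

lemma gderiv_along_line:
  assumes "GDERIV q (x + t *\<^sub>R v) :> g"
  shows "((\<lambda>s. q (x + s *\<^sub>R v)) has_real_derivative g \<bullet> v) (at t)"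
proof -
  have "((\<lambda>s. x + s *\<^sub>R v) has_derivative (\<lambda>s. s *\<^sub>R v)) (at t)"
    by (auto intro!: derivative_eq_intros)
  from has_derivative_compose[OF this, of q "\<lambda>h. h \<bullet> g"] assms
  have "((\<lambda>s. q (x + s *\<^sub>R v)) has_derivative (\<lambda>s. (s *\<^sub>R v) \<bullet> g)) (at t)"
    by (simp add: gderiv_def)
  then show ?thesis
    by (simp add: has_field_derivative_def inner_commute mult_commute_abs)
qed

text \<open>
On a segment, convexity bounds every right difference quotient at \<open>x\<close> by the quotient
over the whole segment; the slope at \<open>x\<close> is the limit of the former.
\<close>
lemma convex_gradient_inequality:
  fixes q :: "'a::real_inner \<Rightarrow> real"
  assumes conv: "convex_on UNIV q" and der: "GDERIV q x :> g"
  shows "q x + g \<bullet> (z - x) \<le> q z"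
proof -
  have lim: "((\<lambda>t. (1 / t) *\<^sub>R (q (x + t *\<^sub>R (z - x)) - q x)) \<longlongrightarrow> (z - x) \<bullet> g) (at_right 0)"
    using directional_derivative_right[of q "\<lambda>h. h \<bullet> g"] der by (simp add: gderiv_def)
  have le: "\<forall>\<^sub>F t in at_right 0. (1 / t) *\<^sub>R (q (x + t *\<^sub>R (z - x)) - q x) \<le> q z - q x"
    using eventually_at_right_real[of 0 1, simplified]
  proof eventually_elim
    case (elim t)
    then have "q ((1 - t) *\<^sub>R x + t *\<^sub>R z) \<le> (1 - t) * q x + t * q z"
      by (intro convex_onD[OF conv]) auto
    then have "q (x + t *\<^sub>R (z - x)) - q x \<le> t * (q z - q x)"
      by (simp add: algebra_simps)
    with elim show ?case by (simp add: field_simps)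
  qed
  have "(z - x) \<bullet> g \<le> q z - q x"
    by (rule tendsto_upperbound[OF lim le]) simp
  then show ?thesis by (simp add: inner_commute)
qed

text \<open>
The mean value theorem in the direction \<open>v\<close> turns the second difference into
\<open>t\<close> times a difference of gradients at two points that both lie within \<open>O(t)\<close> of
\<open>x\<close>; the differentiability of the gradient at the single point \<open>x\<close> then suffices to
replace that difference by \<open>t H u\<close> up to \<open>o(t)\<close>.
\<close>
lemma second_difference_quotient_tendsto:
  fixes q :: "'a::real_inner \<Rightarrow> real"
  assumes grad: "\<And>z. GDERIV q z :> gq z"
    and hess: "(gq has_derivative H) (at x)"
  shows "((\<lambda>t. (q (x + t *\<^sub>R u + t *\<^sub>R v) - q (x + t *\<^sub>R u) - q (x + t *\<^sub>R v) + q x) / t\<^sup>2)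
      \<longlongrightarrow> H u \<bullet> v) (at_right 0)" (is "(?Q \<longlongrightarrow> _) _")
proof (rule tendstoI)
  fix e :: real assume "e > 0"
  interpret bounded_linear H using hess by (rule has_derivative_bounded_linear)
  define N where "N = norm u + norm v"
  \<comment> \<open>The error below is at most \<open>2 r N norm v\<close>; adding \<open>1\<close> makes the denominator positive.\<close>
  define r where "r = e / (2 * N * norm v + 1)"
  have "N \<ge> 0" by (simp add: N_def)
  then have den: "2 * N * norm v + 1 > 0" by (intro add_nonneg_pos) auto
  with \<open>e > 0\<close> have "r > 0" by (simp add: r_def)
  from hess \<open>r > 0\<close> obtain s where "s > 0"
    and s: "\<And>y. norm (y - x) < s \<Longrightarrow> norm (gq y - gq x - H (y - x)) \<le> r * norm (y - x)"
    unfolding has_derivative_at_alt by blast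
  have "s / (N + 1) > 0" using \<open>s > 0\<close> \<open>N \<ge> 0\<close> by simp
  from eventually_at_right_real[OF this]
  show "\<forall>\<^sub>F t in at_right 0. dist (?Q t) (H u \<bullet> v) < e"
  proof eventually_elim
    case (elim t)
    then have "t > 0" and "t * (N + 1) < s" using \<open>N \<ge> 0\<close> by (auto simp: field_simps)
    with \<open>N \<ge> 0\<close> have tN: "t * N < s" by (simp add: algebra_simps)
    have "\<exists>\<theta>>0. \<theta> < t \<and> (q (x + t *\<^sub>R u + t *\<^sub>R v) - q (x + t *\<^sub>R v)) - (q (x + t *\<^sub>R u + 0 *\<^sub>R v) - q (x + 0 *\<^sub>R v))
        = (t - 0) * ((gq (x + t *\<^sub>R u + \<theta> *\<^sub>R v) - gq (x + \<theta> *\<^sub>R v)) \<bullet> v)"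
      using \<open>t > 0\<close>
      by (intro MVT2[where f = "\<lambda>s. q (x + t *\<^sub>R u + s *\<^sub>R v) - q (x + s *\<^sub>R v)"])
         (auto intro!: DERIV_diff gderiv_along_line grad simp: inner_diff_left)
    then obtain \<theta> where \<theta>: "0 < \<theta>" "\<theta> < t"
      and eq: "q (x + t *\<^sub>R u + t *\<^sub>R v) - q (x + t *\<^sub>R u) - q (x + t *\<^sub>R v) + q x
        = t * ((gq (x + t *\<^sub>R u + \<theta> *\<^sub>R v) - gq (x + \<theta> *\<^sub>R v)) \<bullet> v)"
      by (auto simp: algebra_simps)
    have small: "norm (gq y - gq x - H (y - x)) \<le> r * (t * N)" if "norm (y - x) \<le> t * N" for y
      using s[of y] that tN \<open>r > 0\<close> by (meson le_less_trans mult_left_mono less_imp_le order_trans)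
    have "norm (t *\<^sub>R u + \<theta> *\<^sub>R v) \<le> t * norm u + t * norm v"
      using \<theta> by (intro norm_triangle_le add_mono) (auto intro: mult_right_mono)
    then have e1: "norm (gq (x + t *\<^sub>R u + \<theta> *\<^sub>R v) - gq x - H (t *\<^sub>R u + \<theta> *\<^sub>R v)) \<le> r * (t * N)"
      using small[of "x + t *\<^sub>R u + \<theta> *\<^sub>R v"] by (simp add: N_def algebra_simps)
    have "norm (\<theta> *\<^sub>R v) \<le> t * N"
      using \<theta> by (auto simp: N_def intro: mult_mono)
    then have e2: "norm (gq (x + \<theta> *\<^sub>R v) - gq x - H (\<theta> *\<^sub>R v)) \<le> r * (t * N)"
      using small[of "x + \<theta> *\<^sub>R v"] by simp
    define D where "D = gq (x + t *\<^sub>R u + \<theta> *\<^sub>R v) - gq (x + \<theta> *\<^sub>R v)"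
    define E where "E = D - t *\<^sub>R H u"
    have "E = (gq (x + t *\<^sub>R u + \<theta> *\<^sub>R v) - gq x - H (t *\<^sub>R u + \<theta> *\<^sub>R v))
        - (gq (x + \<theta> *\<^sub>R v) - gq x - H (\<theta> *\<^sub>R v))"
      by (simp add: D_def E_def add scaleR)
    then have E: "norm E \<le> 2 * (r * (t * N))"
      using norm_triangle_le_diff[OF add_mono[OF e1 e2]] by (simp only: mult_2)
    have "?Q t - H u \<bullet> v = (E \<bullet> v) / t"
      using \<open>t > 0\<close> unfolding eq E_def D_def[symmetric] inner_diff_left inner_scaleR_left
      by (simp add: diff_divide_distrib power2_eq_square)
    also have "\<bar>\<dots>\<bar> \<le> norm E * norm v / t"
      using \<open>t > 0\<close> Cauchy_Schwarz_ineq2[of E v] by (simp add: abs_divide divide_right_mono)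
    also have "\<dots> \<le> 2 * (r * (t * N)) * norm v / t"
      using \<open>t > 0\<close> E by (intro divide_right_mono mult_right_mono) auto
    also have "\<dots> = r * (2 * N * norm v)" using \<open>t > 0\<close> by simp
    also have "\<dots> < r * (2 * N * norm v + 1)" using \<open>r > 0\<close> by simp
    also have "\<dots> = e" using den by (simp add: r_def)
    finally show ?case by (simp add: dist_real_def)
  qed
qed

text \<open>
The second difference is symmetric in the two directions, hence so is its limit.
\<close>
lemma hessian_symmetric:
  fixes q :: "'a::real_inner \<Rightarrow> real"
  assumes grad: "\<And>z. GDERIV q z :> gq z"
    and hess: "(gq has_derivative H) (at x)"
  shows "H u \<bullet> v = H v \<bullet> u"
proof (rule tendsto_unique[OF trivial_limit_at_right_real])
  show "((\<lambda>t. (q (x + t *\<^sub>R u + t *\<^sub>R v) - q (x + t *\<^sub>R u) - q (x + t *\<^sub>R v) + q x) / t\<^sup>2)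
      \<longlongrightarrow> H u \<bullet> v) (at_right 0)"
    by (rule second_difference_quotient_tendsto[OF grad hess])
  show "((\<lambda>t. (q (x + t *\<^sub>R u + t *\<^sub>R v) - q (x + t *\<^sub>R u) - q (x + t *\<^sub>R v) + q x) / t\<^sup>2)
      \<longlongrightarrow> H v \<bullet> u) (at_right 0)"
    using second_difference_quotient_tendsto[OF grad hess, of v u] by (simp add: algebra_simps)
qed

text \<open>
Adding the gradient inequality at two points shows that the gradient of a convex function is
monotone; the Hessian form inherits the sign from the difference quotients.
\<close>
lemma convex_hessian_nonneg:
  fixes q :: "'a::real_inner \<Rightarrow> real"
  assumes conv: "convex_on UNIV q" and grad: "\<And>z. GDERIV q z :> gq z"
    and hess: "(gq has_derivative H) (at x)"
  shows "0 \<le> H v \<bullet> v"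
proof -
  have lim: "((\<lambda>t. (1 / t) *\<^sub>R (gq (x + t *\<^sub>R v) - gq x) \<bullet> v) \<longlongrightarrow> H v \<bullet> v) (at_right 0)"
    by (intro tendsto_inner directional_derivative_right hess tendsto_const)
  have "\<forall>\<^sub>F t in at_right 0. 0 \<le> (1 / t) *\<^sub>R (gq (x + t *\<^sub>R v) - gq x) \<bullet> v"
    using eventually_at_right_less[of "0::real"]
  proof eventually_elim
    case (elim t)
    have "q (x + t *\<^sub>R v) + gq (x + t *\<^sub>R v) \<bullet> (x - (x + t *\<^sub>R v)) \<le> q x"
      and "q x + gq x \<bullet> (x + t *\<^sub>R v - x) \<le> q (x + t *\<^sub>R v)"
      using convex_gradient_inequality[OF conv grad] by blast+
    then have "0 \<le> t * ((gq (x + t *\<^sub>R v) - gq x) \<bullet> v)"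
      by (simp add: inner_diff_left algebra_simps)
    with elim show ?case by (simp add: zero_le_mult_iff)
  qed
  then show ?thesis by (rule tendsto_lowerbound[OF lim]) simp
qed

lemma lipschitz_derivative_norm_le:
  assumes lip: "L-lipschitz_on UNIV f" and der: "(f has_derivative f') (at x)"
  shows "norm (f' v) \<le> L * norm v"
proof -
  have lim: "((\<lambda>t. norm ((1 / t) *\<^sub>R (f (x + t *\<^sub>R v) - f x))) \<longlongrightarrow> norm (f' v)) (at_right 0)"
    by (intro tendsto_norm directional_derivative_right der)
  have "\<forall>\<^sub>F t in at_right 0. norm ((1 / t) *\<^sub>R (f (x + t *\<^sub>R v) - f x)) \<le> L * norm v"
    using eventually_at_right_less[of "0::real"]
  proof eventually_elim
    case (elim t)
    have "norm (f (x + t *\<^sub>R v) - f x) \<le> L * norm (x + t *\<^sub>R v - x)"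
      using lipschitz_onD[OF lip, of "x + t *\<^sub>R v" x] by (simp add: dist_norm)
    then have "norm (f (x + t *\<^sub>R v) - f x) / t \<le> L * norm v"
      using elim by (simp add: pos_divide_le_eq mult_ac)
    with elim show ?case unfolding norm_scaleR by simp
  qed
  then show ?thesis by (rule tendsto_upperbound[OF lim]) simp
qed

text \<open>
The difference between the two sides, along the segment from \<open>x\<close> to \<open>x + v\<close>, has
nonpositive derivative because the slope grows at rate at most \<open>L (norm v)\<^sup>2\<close>.
\<close>
lemma lipschitz_gradient_quadratic_upper_bound:
  fixes q :: "'a::real_inner \<Rightarrow> real"
  assumes grad: "\<And>z. GDERIV q z :> gq z" and lip: "L-lipschitz_on UNIV gq"
  shows "q (x + v) \<le> q x + gq x \<bullet> v + L / 2 * (norm v)\<^sup>2"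
proof -
  let ?\<phi> = "\<lambda>t. q (x + t *\<^sub>R v) - t * (gq x \<bullet> v) - t\<^sup>2 * (L / 2 * (norm v)\<^sup>2)"
  have "?\<phi> 1 \<le> ?\<phi> 0"
  proof (rule DERIV_nonpos_imp_nonincreasing[where a = 0 and b = 1])
    fix t :: real assume t: "0 \<le> t" "t \<le> 1"
    have "(?\<phi> has_real_derivative
        gq (x + t *\<^sub>R v) \<bullet> v - gq x \<bullet> v - t * (L * (norm v)\<^sup>2)) (at t)"
      by (auto intro!: derivative_eq_intros gderiv_along_line grad)
    moreover have "(gq (x + t *\<^sub>R v) - gq x) \<bullet> v \<le> L * norm (t *\<^sub>R v) * norm v"
      using lipschitz_onD[OF lip, of "x + t *\<^sub>R v" x]
      by (intro order_trans[OF norm_cauchy_schwarz] mult_right_mono) (auto simp: dist_norm)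
    then have "gq (x + t *\<^sub>R v) \<bullet> v - gq x \<bullet> v - t * (L * (norm v)\<^sup>2) \<le> 0"
      using t by (simp add: inner_diff_left power2_eq_square mult_ac)
    ultimately show "\<exists>y. (?\<phi> has_real_derivative y) (at t) \<and> y \<le> 0" by blast
  qed simp
  then show ?thesis by simp
qed

section \<open>Inclusions with a convex subdifferential\<close>

lemma subdifferential_monotone:
  assumes "g \<in> subdifferential h z" and "g' \<in> subdifferential h z'"
  shows "0 \<le> (g - g') \<bullet> (z - z')"
proof -
  have "h z + g \<bullet> (z' - z) \<le> h z'" and "h z' + g' \<bullet> (z - z') \<le> h z"
    using assms by (auto simp: subdifferential_def)
  then show ?thesis by (simp add: inner_diff_left inner_diff_right)
qed

lemma subdifferential_closed_graph:
  fixes h :: "'a::euclidean_space \<Rightarrow> real"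
  assumes conv: "convex_on UNIV h"
    and sub: "\<And>n::nat. g n \<in> subdifferential h (y n)"
    and g: "g \<longlonglongrightarrow> g'" and y: "y \<longlonglongrightarrow> y'"
  shows "g' \<in> subdifferential h y'"
proof -
  have "continuous_on UNIV h" using conv by (intro convex_on_continuous) auto
  then have "(\<lambda>n. h (y n)) \<longlonglongrightarrow> h y'"
    by (rule continuous_on_tendsto_compose[OF _ y]) auto
  then have lim: "(\<lambda>n. h (y n) + g n \<bullet> (z - y n)) \<longlonglongrightarrow> h y' + g' \<bullet> (z - y')" for z
    by (intro tendsto_intros g y)
  have "h y' + g' \<bullet> (z - y') \<le> h z" for z
    using sub by (intro LIMSEQ_le_const2[OF lim]) (auto simp: subdifferential_def)
  then show ?thesis by (simp add: subdifferential_def)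
qed

text \<open>
A finite convex function on a Euclidean space may tend to \<open>-\<infinity>\<close>, but only linearly: its
values on the unit sphere about \<open>w\<close> bound the slope of its descent along every ray from
\<open>w\<close>. The quadratic term therefore dominates, and the search for a minimiser can be
restricted to a ball.
\<close>
lemma convex_quadratic_perturbation_attains_min:
  fixes h :: "'a::euclidean_space \<Rightarrow> real"
  assumes conv: "convex_on UNIV h" and "\<mu> > 0"
  shows "\<exists>z. \<forall>y. h z + \<mu> * (norm (z - w))\<^sup>2 \<le> h y + \<mu> * (norm (y - w))\<^sup>2"
proof -
  define F where "F y = h y + \<mu> * (norm (y - w))\<^sup>2" for y
  have conth: "continuous_on UNIV h" using conv by (intro convex_on_continuous) auto
  obtain m where m: "\<And>y. norm (y - w) = 1 \<Longrightarrow> h w - m \<le> h y"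
  proof -
    have "\<exists>y\<in>sphere w 1. \<forall>z\<in>sphere w 1. h y \<le> h z"
      using continuous_on_subset[OF conth] by (intro continuous_attains_inf) auto
    then obtain y0 where "\<And>z. z \<in> sphere w 1 \<Longrightarrow> h y0 \<le> h z" by blast
    then have "\<And>y. norm (y - w) = 1 \<Longrightarrow> h w - (h w - h y0) \<le> h y"
      by (simp add: dist_norm norm_minus_commute)
    with that show ?thesis by blast
  qed
  have linear_bound: "h w - m * norm (y - w) \<le> h y" if "norm (y - w) \<ge> 1" for y
  proof -
    define n where "n = norm (y - w)"
    have n: "n \<ge> 1" using that by (simp add: n_def)
    have "h w - m \<le> h (w + (1 / n) *\<^sub>R (y - w))"
      using n by (intro m) (auto simp: n_def)
    also have "w + (1 / n) *\<^sub>R (y - w) = (1 - 1 / n) *\<^sub>R w + (1 / n) *\<^sub>R y"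
      by (simp add: algebra_simps)
    also have "h \<dots> \<le> (1 - 1 / n) * h w + (1 / n) * h y"
      using n by (intro convex_onD[OF conv]) auto
    finally have "n * (h w - m) \<le> n * ((1 - 1 / n) * h w + (1 / n) * h y)"
      using n by (intro mult_left_mono) auto
    also have "\<dots> = (n - 1) * h w + h y" using n by (simp add: field_simps)
    finally show ?thesis unfolding n_def[symmetric] by (simp add: algebra_simps)
  qed
  \<comment> \<open>Beyond this radius the quadratic term makes up for the linear loss, so no value lies below
    the value at the centre \<open>w\<close>.\<close>
  define R where "R = max 1 (m / \<mu>)"
  have "\<exists>z\<in>cball w R. \<forall>y\<in>cball w R. F z \<le> F y"
    unfolding F_def R_def
    by (intro continuous_attains_inf continuous_intros continuous_on_subset[OF conth]) auto
  then obtain z where z: "\<And>y. y \<in> cball w R \<Longrightarrow> F z \<le> F y" by blast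
  have "F z \<le> F y" for y
  proof (cases "y \<in> cball w R")
    case False
    then have n: "norm (y - w) \<ge> 1" "norm (y - w) \<ge> m / \<mu>"
      by (auto simp: R_def dist_norm norm_minus_commute)
    then have "m * norm (y - w) \<le> (\<mu> * norm (y - w)) * norm (y - w)"
      using \<open>\<mu> > 0\<close> by (intro mult_right_mono) (auto simp: field_simps)
    with linear_bound[OF n(1)] have "F w \<le> F y"
      by (simp add: F_def power2_eq_square mult_ac)
    moreover have "F z \<le> F w" by (rule z) (simp add: R_def)
    ultimately show ?thesis by simp
  qed (rule z)
  then show ?thesis unfolding F_def by blast
qed

text \<open>
First-order optimality: compare the minimiser with the points
of the segment to \<open>y\<close>, divide by the parameter \<open>t\<close> and let it tend to \<open>0\<close>, which removes the
quadratic remainder.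
\<close>
lemma subdifferential_at_proximal_point:
  fixes h :: "'a::real_inner \<Rightarrow> real"
  assumes conv: "convex_on UNIV h"
    and min: "\<And>y. h z + \<mu> * (norm (z - w))\<^sup>2 \<le> h y + \<mu> * (norm (y - w))\<^sup>2"
  shows "(2 * \<mu>) *\<^sub>R (w - z) \<in> subdifferential h z"
proof -
  have "h z + ((2 * \<mu>) *\<^sub>R (w - z)) \<bullet> (y - z) \<le> h y" for y
  proof -
    have le: "\<forall>\<^sub>F t in at_right 0. 2 * \<mu> * ((w - z) \<bullet> (y - z)) \<le> h y - h z + t * (\<mu> * (norm (y - z))\<^sup>2)"
      using eventually_at_right_real[of 0 1, simplified]
    proof eventually_elim
      case (elim t)
      have "(norm (z + t *\<^sub>R (y - z) - w))\<^sup>2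
          = (norm (z - w))\<^sup>2 - 2 * t * ((w - z) \<bullet> (y - z)) + t\<^sup>2 * (norm (y - z))\<^sup>2"
        unfolding power2_norm_eq_inner
        by (simp add: algebra_simps power2_eq_square inner_commute)
      moreover have "h ((1 - t) *\<^sub>R z + t *\<^sub>R y) \<le> (1 - t) * h z + t * h y"
        using elim by (intro convex_onD[OF conv]) auto
      then have "h (z + t *\<^sub>R (y - z)) \<le> h z + t * (h y - h z)"
        by (simp add: algebra_simps)
      ultimately have "h z + \<mu> * (norm (z - w))\<^sup>2 \<le> h z + t * (h y - h z)
          + \<mu> * ((norm (z - w))\<^sup>2 - 2 * t * ((w - z) \<bullet> (y - z)) + t\<^sup>2 * (norm (y - z))\<^sup>2)"
        using min[of "z + t *\<^sub>R (y - z)"] by simp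
      then have "t * (2 * \<mu> * ((w - z) \<bullet> (y - z))) \<le> t * (h y - h z + t * (\<mu> * (norm (y - z))\<^sup>2))"
        by (simp add: distrib_left right_diff_distrib power2_eq_square mult_ac)
      with elim show ?case by simp
    qed
    have lim: "((\<lambda>t. h y - h z + t * (\<mu> * (norm (y - z))\<^sup>2)) \<longlongrightarrow> h y - h z + 0 * (\<mu> * (norm (y - z))\<^sup>2))
        (at_right 0)"
      by (intro tendsto_intros)
    have "2 * \<mu> * ((w - z) \<bullet> (y - z)) \<le> h y - h z + 0 * (\<mu> * (norm (y - z))\<^sup>2)"
      by (rule tendsto_lowerbound[OF lim le]) simp
    then show ?thesis by simp
  qed
  then show ?thesis by (simp add: subdifferential_def)
qed

text \<open>
Uniqueness follows from monotonicity of the subdifferential against strong monotonicity of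
\<open>T\<close>. For existence, \<open>T\<close> need not be symmetric, so there is no energy to minimise. Instead,
for any \<open>\<gamma> > 0\<close> the solutions are the fixed points of the forward-backward map
\<open>z \<mapsto> P (z - \<gamma> (T z + c))\<close>, where \<open>P\<close> is the proximal map of \<open>h\<close> with step \<open>\<gamma>\<close>. As
\<open>P\<close> is nonexpansive and \<open>I - \<gamma> T\<close> is a contraction for small \<open>\<gamma>\<close>, Banach's theorem applies.
\<close>
lemma strongly_monotone_inclusion_ex1:
  fixes h :: "'a::euclidean_space \<Rightarrow> real" and T :: "'a \<Rightarrow> 'a"
  assumes conv: "convex_on UNIV h" and lin: "linear T"
    and "\<delta> > 0" and mono: "\<And>v. \<delta> * (norm v)\<^sup>2 \<le> v \<bullet> T v"
  shows "\<exists>!z. 0 \<in> (\<lambda>g. T z + c + g) ` subdifferential h z"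
proof (rule ex_ex1I)
  interpret T: linear T by (rule lin)
  obtain M where M: "\<And>v. norm (T v) \<le> M * norm v" and "M > 0"
    using linear_bounded_pos[OF lin] by auto
  \<comment> \<open>This step minimises \<open>1 - 2 \<gamma> \<delta> + \<gamma>\<^sup>2 (M\<^sup>2 + \<delta>\<^sup>2)\<close>, a bound on the squared contraction
    factor; adding \<open>\<delta>\<^sup>2\<close> to \<open>M\<^sup>2\<close> makes the minimum positive without a comparison of \<open>\<delta>\<close> with \<open>M\<close>.\<close>
  define \<gamma> where "\<gamma> = \<delta> / (M\<^sup>2 + \<delta>\<^sup>2)"
  have "M\<^sup>2 + \<delta>\<^sup>2 > 0" using \<open>\<delta> > 0\<close> by (intro add_nonneg_pos) auto
  then have "\<gamma> > 0" using \<open>\<delta> > 0\<close> by (simp add: \<gamma>_def)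
  have "\<forall>w. \<exists>z. \<forall>y. h z + 1 / (2 * \<gamma>) * (norm (z - w))\<^sup>2
      \<le> h y + 1 / (2 * \<gamma>) * (norm (y - w))\<^sup>2"
    using \<open>\<gamma> > 0\<close> by (intro allI convex_quadratic_perturbation_attains_min[OF conv]) simp
  from choice[OF this] obtain P where Pmin: "\<And>w y. h (P w) + 1 / (2 * \<gamma>) * (norm (P w - w))\<^sup>2
      \<le> h y + 1 / (2 * \<gamma>) * (norm (y - w))\<^sup>2"
    by blast
  have P: "(1 / \<gamma>) *\<^sub>R (w - P w) \<in> subdifferential h (P w)" for w
    using subdifferential_at_proximal_point[OF conv Pmin, of w] by simp
  have nonexpansive: "norm (P w - P w') \<le> norm (w - w')" for w w'
  proof -
    have "(1 / \<gamma>) *\<^sub>R (w - P w) - (1 / \<gamma>) *\<^sub>R (w' - P w') = (1 / \<gamma>) *\<^sub>R ((w - w') - (P w - P w'))"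
      by (simp add: algebra_simps)
    with subdifferential_monotone[OF P P, of w w'] \<open>\<gamma> > 0\<close>
    have "0 \<le> ((w - w') - (P w - P w')) \<bullet> (P w - P w')"
      by (simp add: zero_le_mult_iff zero_le_divide_iff)
    then have "norm (P w - P w') * norm (P w - P w') \<le> (w - w') \<bullet> (P w - P w')"
      by (simp add: inner_diff_left flip: power2_norm_eq_inner power2_eq_square)
    also have "\<dots> \<le> norm (w - w') * norm (P w - P w')" by (rule norm_cauchy_schwarz)
    finally show ?thesis
      by (cases "norm (P w - P w') = 0") (auto simp: mult_le_cancel_right)
  qed
  define \<rho> where "\<rho> = sqrt (M\<^sup>2 / (M\<^sup>2 + \<delta>\<^sup>2))"
  have \<rho>: "0 \<le> \<rho>" "\<rho> < 1"
    using \<open>M\<^sup>2 + \<delta>\<^sup>2 > 0\<close> \<open>\<delta> > 0\<close> by (auto simp: \<rho>_def)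
  have contraction: "norm (v - \<gamma> *\<^sub>R T v) \<le> \<rho> * norm v" for v
  proof -
    have "(norm (v - \<gamma> *\<^sub>R T v))\<^sup>2 = (norm v)\<^sup>2 - 2 * \<gamma> * (v \<bullet> T v) + \<gamma>\<^sup>2 * (norm (T v))\<^sup>2"
      unfolding power2_norm_eq_inner by (simp add: inner_simps algebra_simps power2_eq_square inner_commute)
    also have "\<dots> \<le> (norm v)\<^sup>2 - 2 * \<gamma> * (\<delta> * (norm v)\<^sup>2) + \<gamma>\<^sup>2 * (M * norm v)\<^sup>2"
      using \<open>\<gamma> > 0\<close> mono[of v] M[of v]
      by (intro add_mono diff_mono mult_left_mono power_mono) auto
    also have "\<dots> \<le> (norm v)\<^sup>2 - 2 * \<gamma> * (\<delta> * (norm v)\<^sup>2) + \<gamma>\<^sup>2 * ((M\<^sup>2 + \<delta>\<^sup>2) * (norm v)\<^sup>2)"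
      by (intro add_left_mono mult_left_mono) (auto simp: power_mult_distrib intro!: mult_right_mono)
    also have "\<gamma>\<^sup>2 * ((M\<^sup>2 + \<delta>\<^sup>2) * (norm v)\<^sup>2) = \<gamma> * (\<delta> * (norm v)\<^sup>2)"
      using \<open>M\<^sup>2 + \<delta>\<^sup>2 > 0\<close> by (simp add: \<gamma>_def power2_eq_square)
    also have "(norm v)\<^sup>2 - 2 * \<gamma> * (\<delta> * (norm v)\<^sup>2) + \<gamma> * (\<delta> * (norm v)\<^sup>2) = (1 - \<gamma> * \<delta>) * (norm v)\<^sup>2"
      by (simp add: algebra_simps)
    also have "1 - \<gamma> * \<delta> = M\<^sup>2 / (M\<^sup>2 + \<delta>\<^sup>2)"
      using \<open>M\<^sup>2 + \<delta>\<^sup>2 > 0\<close> by (auto simp: \<gamma>_def diff_eq_eq simp flip: add_divide_distrib power2_eq_square)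
    also have "\<dots> * (norm v)\<^sup>2 = (\<rho> * norm v)\<^sup>2"
      using \<open>M\<^sup>2 + \<delta>\<^sup>2 > 0\<close> by (simp add: \<rho>_def power_mult_distrib)
    finally show ?thesis using \<rho> by (auto intro: power2_le_imp_le)
  qed
  have "\<exists>!z. P (z - \<gamma> *\<^sub>R (T z + c)) = z"
  proof (rule banach_fix_type[OF \<rho>], intro allI)
    fix z z'
    have "dist (P (z - \<gamma> *\<^sub>R (T z + c))) (P (z' - \<gamma> *\<^sub>R (T z' + c)))
        \<le> norm ((z - \<gamma> *\<^sub>R (T z + c)) - (z' - \<gamma> *\<^sub>R (T z' + c)))"
      unfolding dist_norm by (rule nonexpansive)
    also have "(z - \<gamma> *\<^sub>R (T z + c)) - (z' - \<gamma> *\<^sub>R (T z' + c)) = (z - z') - \<gamma> *\<^sub>R T (z - z')"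
      by (simp add: T.diff algebra_simps)
    also have "norm \<dots> \<le> \<rho> * dist z z'" unfolding dist_norm by (rule contraction)
    finally show "dist (P (z - \<gamma> *\<^sub>R (T z + c))) (P (z' - \<gamma> *\<^sub>R (T z' + c))) \<le> \<rho> * dist z z'" .
  qed
  then obtain z where z: "P (z - \<gamma> *\<^sub>R (T z + c)) = z" by blast
  have "(1 / \<gamma>) *\<^sub>R (z - \<gamma> *\<^sub>R (T z + c) - z) \<in> subdifferential h z"
    using P[of "z - \<gamma> *\<^sub>R (T z + c)"] by (simp only: z)
  then have "- (T z + c) \<in> subdifferential h z"
    using \<open>\<gamma> > 0\<close> by simp
  then show "\<exists>z. 0 \<in> (\<lambda>g. T z + c + g) ` subdifferential h z" by force
next
  interpret T: linear T by (rule lin)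
  fix z z'
  assume "0 \<in> (\<lambda>g. T z + c + g) ` subdifferential h z"
    and "0 \<in> (\<lambda>g. T z' + c + g) ` subdifferential h z'"
  then obtain g g' where g: "g \<in> subdifferential h z" "T z + c + g = 0"
    and g': "g' \<in> subdifferential h z'" "T z' + c + g' = 0"
    by (auto dest!: sym[of 0])
  then have "g - g' = - T (z - z')"
    by (simp add: T.diff add_eq_0_iff algebra_simps)
  with subdifferential_monotone[OF g(1) g'(1)]
  have "(z - z') \<bullet> T (z - z') \<le> 0" by (simp add: inner_commute)
  with mono[of "z - z'"] have "\<delta> * (norm (z - z'))\<^sup>2 \<le> 0" by linarith
  with \<open>\<delta> > 0\<close> show "z = z'" by (simp add: mult_le_0_iff)
qed

section \<open>The triangular splitting\<close>

text \<open>
By symmetry of \<open>A\<close> the strictly lower and the strictly upper triangle contribute equally to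
the quadratic form, so the lower triangle together with half of the diagonal contributes half of
the nonnegative form of \<open>A\<close>. What remains of \<open>split_B\<close> is \<open>1/\<omega> - 1/2 > 0\<close> times the
diagonal plus \<open>\<epsilon> I\<close>, and this is where \<open>split_delta\<close> comes from.
\<close>
lemma split_B_strongly_monotone:
  fixes A :: "real ^ 'n::{finite,linorder} ^ 'n::_"
  assumes symm: "\<And>i j. A $ i $ j = A $ j $ i" and psd: "\<And>v. 0 \<le> v \<bullet> (A *v v)"
    and \<omega>: "0 < \<omega>" "\<omega> < 2"
  shows "split_delta \<omega> \<epsilon> A * (norm v)\<^sup>2 \<le> v \<bullet> (split_B \<omega> \<epsilon> A *v v)"
proof -
  define Lo where "Lo = (\<Sum>i\<in>UNIV. \<Sum>j\<in>UNIV. if j < i then v $ i * A $ i $ j * v $ j else 0)"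
  define Up where "Up = (\<Sum>i\<in>UNIV. \<Sum>j\<in>UNIV. if i < j then v $ i * A $ i $ j * v $ j else 0)"
  define Di where "Di = (\<Sum>i\<in>UNIV. A $ i $ i * (v $ i)\<^sup>2)"
  have "Lo = (\<Sum>j\<in>UNIV. \<Sum>i\<in>UNIV. if j < i then v $ i * A $ i $ j * v $ j else 0)"
    unfolding Lo_def by (rule sum.swap)
  then have "Lo = Up" by (simp add: Up_def symm mult_ac cong: if_cong)
  have form: "v \<bullet> (N *v v) = (\<Sum>i\<in>UNIV. \<Sum>j\<in>UNIV. v $ i * N $ i $ j * v $ j)" for N :: "real ^ 'n::_ ^ 'n::_"
    by (simp add: inner_vec_def matrix_vector_mult_def sum_distrib_left mult_ac)
  have diag: "(\<Sum>i\<in>UNIV. \<Sum>j\<in>UNIV. if i = j then v $ i * A $ i $ j * v $ j else 0) = Di"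
    by (simp add: Di_def power2_eq_square mult_ac)
  have A_form: "v \<bullet> (A *v v) = Lo + Di + Up"
    unfolding form Lo_def Up_def diag[symmetric] sum.distrib[symmetric]
    by (intro sum.cong refl) auto
  have L_form: "v \<bullet> (strict_lower_part A *v v) = Lo"
    unfolding form Lo_def strict_lower_part_def by (intro sum.cong refl) auto
  have D_form: "v \<bullet> (diag_part A *v v) = Di"
    unfolding form diag[symmetric] diag_part_def by (intro sum.cong refl) auto
  have B_form: "v \<bullet> (split_B \<omega> \<epsilon> A *v v) = Lo + 1 / \<omega> * Di + \<epsilon> * (norm v)\<^sup>2"
    by (simp add: split_B_def matrix_vector_mult_add_rdistrib inner_add_right L_form D_form
        scaleR_matrix_vector_assoc[symmetric] power2_norm_eq_inner)
  define \<mu> where "\<mu> = Min (range (\<lambda>i. diag_part A $ i $ i))"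
  have "\<mu> * (norm v)\<^sup>2 = (\<Sum>i\<in>UNIV. \<mu> * (v $ i)\<^sup>2)"
    unfolding power2_norm_eq_inner inner_vec_def by (simp add: sum_distrib_left power2_eq_square)
  also have "\<dots> \<le> Di"
    unfolding Di_def
  proof (intro sum_mono mult_right_mono)
    fix i
    have "\<mu> \<le> diag_part A $ i $ i" unfolding \<mu>_def by (intro Min_le) auto
    then show "\<mu> \<le> A $ i $ i" by (simp add: diag_part_def)
  qed auto
  finally have "(1 / \<omega> - 1 / 2) * (\<mu> * (norm v)\<^sup>2) \<le> (1 / \<omega> - 1 / 2) * Di"
    using \<omega> by (intro mult_left_mono) (auto simp: field_simps)
  moreover have "0 \<le> Lo + 1 / 2 * Di"
    using psd[of v] A_form \<open>Lo = Up\<close> by simp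
  ultimately show ?thesis
    unfolding B_form split_delta_def \<mu>_def[symmetric] by (simp add: algebra_simps)
qed

text \<open>
The bound depends on \<open>A\<close> only through its operator norm, hence is uniform over all Hessians
of a function with Lipschitz gradient. The crude dimension factor is harmless.
\<close>
lemma norm_split_B_mult_le:
  fixes A :: "real ^ 'n::{finite,linorder} ^ 'n::_"
  assumes bound: "\<And>v. norm (A *v v) \<le> K * norm v" and "\<omega> > 0" "\<epsilon> \<ge> 0"
  shows "norm (split_B \<omega> \<epsilon> A *v v) \<le> (real CARD('n))\<^sup>2 * (K + K / \<omega> + \<epsilon>) * norm v"
proof -
  have entry: "\<bar>A $ i $ j\<bar> \<le> K" for i j
  proof -
    have "\<bar>A $ i $ j\<bar> = \<bar>(A *v axis j 1) $ i\<bar>"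
      by (simp add: matrix_vector_mult_basis column_def)
    also have "\<dots> \<le> norm (A *v axis j 1)" by (rule component_le_norm_cart)
    also have "\<dots> \<le> K" using bound[of "axis j 1"] by simp
    finally show ?thesis .
  qed
  then have "K \<ge> 0" by (meson abs_ge_zero order_trans)
  have "\<bar>split_B \<omega> \<epsilon> A $ i $ j\<bar> \<le> K + K / \<omega> + \<epsilon>" for i j
  proof -
    have "\<bar>strict_lower_part A $ i $ j\<bar> \<le> K"
      using entry[of i j] \<open>K \<ge> 0\<close> by (simp add: strict_lower_part_def)
    moreover have "\<bar>(1 / \<omega>) * diag_part A $ i $ j\<bar> \<le> K / \<omega>"
      using entry[of i j] \<open>K \<ge> 0\<close> \<open>\<omega> > 0\<close> by (auto simp: diag_part_def abs_mult intro: divide_right_mono)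
    moreover have "\<bar>\<epsilon> * (mat 1 :: real ^ 'n::_ ^ 'n::_) $ i $ j\<bar> \<le> \<epsilon>"
      using \<open>\<epsilon> \<ge> 0\<close> by (simp add: mat_def)
    ultimately have "\<bar>strict_lower_part A $ i $ j + (1 / \<omega>) * diag_part A $ i $ j
        + \<epsilon> * (mat 1 :: real ^ 'n::_ ^ 'n::_) $ i $ j\<bar> \<le> K + K / \<omega> + \<epsilon>"
      by linarith
    then show ?thesis by (simp add: split_B_def)
  qed
  then have "onorm ((*v) (split_B \<omega> \<epsilon> A)) \<le> real CARD('n) * real CARD('n) * (K + K / \<omega> + \<epsilon>)"
    by (rule onorm_le_matrix_component)
  then have "onorm ((*v) (split_B \<omega> \<epsilon> A)) * norm v \<le> real CARD('n) * real CARD('n) * (K + K / \<omega> + \<epsilon>) * norm v"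
    by (rule mult_right_mono) simp
  with onorm[OF matrix_vector_mul_bounded_linear, of "split_B \<omega> \<epsilon> A" v] show ?thesis
    by (simp add: power2_eq_square)
qed

text \<open>
With the linear term \<open>G - A x\<close> of the quadratic model at \<open>x\<close>, the inclusion defining the
operator loses its terms in \<open>A x\<close> and depends on \<open>x\<close> only through the step \<open>y - x\<close>.
\<close>
lemma triangle_prox_step:
  fixes A :: "real ^ 'n::{finite,linorder} ^ 'n::_" and x G :: "real ^ 'n::_"
  assumes symm: "\<And>i j. A $ i $ j = A $ j $ i" and psd: "\<And>v. 0 \<le> v \<bullet> (A *v v)"
    and \<omega>: "0 < \<omega>" "\<omega> < 2" and pos: "split_delta \<omega> \<epsilon> A > 0" and conv: "convex_on UNIV h"
  defines "y \<equiv> triangle_prox \<omega> \<epsilon> x A (G - A *v x) h"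
  shows "- (split_B \<omega> \<epsilon> A *v (y - x)) - G \<in> subdifferential h y"
proof -
  let ?B = "split_B \<omega> \<epsilon> A" and ?c = "split_C \<omega> \<epsilon> A *v x + (G - A *v x)"
  have "\<exists>!z. 0 \<in> (\<lambda>g. ?B *v z + ?c + g) ` subdifferential h z"
    by (rule strongly_monotone_inclusion_ex1[OF conv _ pos split_B_strongly_monotone[OF symm psd \<omega>]])
       (rule matrix_vector_mul_linear)
  then have "0 \<in> (\<lambda>g. ?B *v y + ?c + g) ` subdifferential h y"
    unfolding y_def triangle_prox_def add.assoc[of "?B *v _"] by (rule theI')
  then obtain g where g: "g \<in> subdifferential h y" and "?B *v y + ?c + g = 0"
    by (auto dest!: sym[of 0])
  then have "g = - (?B *v y + ?c)" by (simp add: add_eq_0_iff)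
  also have "\<dots> = - (?B *v (y - x)) - G"
    by (simp add: split_C_def algebra_simps)
  finally show ?thesis using g by simp
qed

section \<open>Backtracking line search\<close>

text \<open>
Insert \<open>x\<close> into the subgradient inequality at \<open>x + d\<close>. For \<open>v = B d\<close> the first hypothesis
is the inclusion solved by a proximal step \<open>d\<close> and the second one is the strong monotonicity of
\<open>B\<close>.
\<close>
lemma model_decrease_le:
  assumes sub: "- v - G \<in> subdifferential h (x + d)" and "\<delta> * (norm d)\<^sup>2 \<le> d \<bullet> v"
  shows "G \<bullet> d + h (x + d) - h x \<le> - (\<delta> * (norm d)\<^sup>2)"
proof -
  have "h (x + d) + (- v - G) \<bullet> (x - (x + d)) \<le> h x"
    using sub unfolding subdifferential_def by blast
  with assms(2) show ?thesis
    by (simp add: inner_diff_left inner_diff_right inner_commute)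
qed

text \<open>
The smooth part may exceed its linearisation by \<open>L a\<^sup>2 (norm d)\<^sup>2 / 2\<close>, while the nonsmooth
part does not exceed its chord. The fraction \<open>1 - \<tau>\<close> of the predicted decrease that the test does not claim pays
for this excess as soon as \<open>a\<close> is short.
\<close>
lemma short_step_sufficient_decrease:
  fixes q h :: "'a::real_inner \<Rightarrow> real"
  assumes grad: "\<And>z. GDERIV q z :> gq z" and lip: "L-lipschitz_on UNIV gq"
    and conv: "convex_on UNIV h"
    and model: "gq x \<bullet> d + h (x + d) - h x \<le> - (\<delta> * (norm d)\<^sup>2)"
    and a: "0 < a" "a \<le> 1" and short: "L * a \<le> 2 * (1 - \<tau>) * \<delta>" and "\<tau> < 1"
  shows "q (x + a *\<^sub>R d) + h (x + a *\<^sub>R d)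
    \<le> q x + h x + a * \<tau> * (gq x \<bullet> d + h (x + d) - h x)"
proof -
  define D where "D = gq x \<bullet> d + h (x + d) - h x"
  have "q (x + a *\<^sub>R d) \<le> q x + a * (gq x \<bullet> d) + a * ((L * a) * (norm d)\<^sup>2) / 2"
    using lipschitz_gradient_quadratic_upper_bound[OF grad lip, of x "a *\<^sub>R d"]
    by (simp add: power_mult_distrib power2_eq_square mult_ac)
  moreover have "h ((1 - a) *\<^sub>R x + a *\<^sub>R (x + d)) \<le> (1 - a) * h x + a * h (x + d)"
    using a by (intro convex_onD[OF conv]) auto
  then have "h (x + a *\<^sub>R d) \<le> h x + a * (h (x + d) - h x)"
    by (simp add: algebra_simps)
  moreover have "(L * a) * (norm d)\<^sup>2 \<le> 2 * (1 - \<tau>) * (- D)"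
  proof -
    have "(L * a) * (norm d)\<^sup>2 \<le> (2 * (1 - \<tau>) * \<delta>) * (norm d)\<^sup>2"
      using short by (intro mult_right_mono) auto
    also have "\<dots> = (2 * (1 - \<tau>)) * (\<delta> * (norm d)\<^sup>2)" by (simp add: mult_ac)
    also have "\<dots> \<le> 2 * (1 - \<tau>) * (- D)"
      using model \<open>\<tau> < 1\<close> by (intro mult_left_mono) (auto simp: D_def)
    finally show ?thesis .
  qed
  then have "a * ((L * a) * (norm d)\<^sup>2) \<le> a * (2 * (1 - \<tau>) * (- D))"
    using a by (intro mult_left_mono) auto
  ultimately show ?thesis
    unfolding D_def[symmetric] by (simp add: D_def algebra_simps)
qed

lemma Greatest_power_least_exponent:
  fixes \<eta> :: real
  assumes \<eta>: "0 < \<eta>" "\<eta> < 1" and ex: "P (\<eta> ^ m)"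
  obtains j where "(GREATEST a. a \<in> range (\<lambda>j::nat. \<eta> ^ j) \<and> P a) = \<eta> ^ j"
    and "P (\<eta> ^ j)" and "\<And>i. i < j \<Longrightarrow> \<not> P (\<eta> ^ i)"
proof -
  define j where "j = (LEAST j. P (\<eta> ^ j))"
  have "P (\<eta> ^ j)" unfolding j_def by (rule LeastI) (rule ex)
  have least: "j \<le> i" if "P (\<eta> ^ i)" for i unfolding j_def by (rule Least_le) (rule that)
  have "(GREATEST a. a \<in> range (\<lambda>j::nat. \<eta> ^ j) \<and> P a) = \<eta> ^ j"
    using \<open>P (\<eta> ^ j)\<close> least \<eta> by (intro Greatest_equality) (auto intro: power_decreasing)
  with \<open>P (\<eta> ^ j)\<close> least show ?thesis by (intro that) (auto simp: not_le[symmetric])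
qed

text \<open>
If the accepted power of \<open>\<eta>\<close> is not \<open>1\<close>, the preceding power was rejected and hence too
long, so that the accepted one is at most a factor \<open>\<eta>\<close> too short. The denominator
\<open>L + 1\<close> replaces \<open>L\<close> to cover \<open>L = 0\<close>.
\<close>
lemma backtracking_step:
  fixes \<eta> \<kappa> L :: real
  assumes \<eta>: "0 < \<eta>" "\<eta> < 1" and "L \<ge> 0" "\<kappa> > 0"
    and accept: "\<And>a. 0 < a \<Longrightarrow> a \<le> 1 \<Longrightarrow> L * a \<le> \<kappa> \<Longrightarrow> P a"
  defines "\<alpha> \<equiv> GREATEST a. a \<in> range (\<lambda>j::nat. \<eta> ^ j) \<and> P a"
  shows "P \<alpha>" and "min 1 (\<eta> * \<kappa> / (L + 1)) \<le> \<alpha>"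
proof -
  have pow: "0 < \<eta> ^ j" "\<eta> ^ j \<le> 1" for j using \<eta> by (auto simp: power_le_one)
  have "\<kappa> / (L + 1) > 0" using \<open>L \<ge> 0\<close> \<open>\<kappa> > 0\<close> by simp
  then obtain m where m: "\<eta> ^ m < \<kappa> / (L + 1)" using real_arch_pow_inv \<eta> by blast
  then have "(L + 1) * \<eta> ^ m < \<kappa>" using \<open>L \<ge> 0\<close> by (simp add: field_simps)
  then have "L * \<eta> ^ m \<le> \<kappa>" using pow(1)[of m] by (simp add: algebra_simps)
  then have "P (\<eta> ^ m)" by (intro accept pow)
  then obtain j where j: "\<alpha> = \<eta> ^ j" "P (\<eta> ^ j)" "\<And>i. i < j \<Longrightarrow> \<not> P (\<eta> ^ i)"
    unfolding \<alpha>_def using Greatest_power_least_exponent[OF \<eta>] by metis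
  then show "P \<alpha>" by simp
  show "min 1 (\<eta> * \<kappa> / (L + 1)) \<le> \<alpha>"
  proof (cases j)
    case 0
    with j show ?thesis by simp
  next
    case (Suc i)
    then have "\<not> P (\<eta> ^ i)" using j by simp
    then have "\<kappa> < L * \<eta> ^ i" using accept pow by (meson not_le)
    also have "\<dots> \<le> (L + 1) * \<eta> ^ i" using pow(1)[of i] by simp
    finally have "\<eta> * \<kappa> \<le> \<eta> * ((L + 1) * \<eta> ^ i)" using \<eta> by simp
    also have "\<dots> = (L + 1) * \<alpha>" using j Suc by simp
    finally have "\<eta> * \<kappa> / (L + 1) \<le> \<alpha>" using \<open>L \<ge> 0\<close> by (simp add: field_simps)
    then show ?thesis by simp
  qed
qed

section \<open>Global convergence\<close>

lemma not_tendsto_0_subseq_bounded_away: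
  fixes u :: "nat \<Rightarrow> real"
  assumes "\<not> u \<longlonglongrightarrow> 0"
  obtains c and s :: "nat \<Rightarrow> nat" where "c > 0" "strict_mono s" "\<And>n. c \<le> \<bar>u (s n)\<bar>"
proof -
  from assms obtain c where "c > 0" and "\<not> (\<forall>\<^sub>F n in sequentially. \<bar>u n\<bar> < c)"
    by (auto simp: tendsto_iff)
  then have "infinite {n. c \<le> \<bar>u n\<bar>}"
    by (simp add: not_eventually not_less frequently_cofinite flip: cofinite_eq_sequentially)
  then obtain s :: "nat \<Rightarrow> nat" where "strict_mono s" "\<And>n. s n \<in> {n. c \<le> \<bar>u n\<bar>}"
    using infinite_enumerate by blast
  with \<open>c > 0\<close> show ?thesis by (intro that[of c s]) auto
qed

theorem theorem7:
  fixes q h f :: "real ^ 'n::{finite,linorder} \<Rightarrow> real"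
    and gq :: "real ^ 'n::_ \<Rightarrow> real ^ 'n::_"
    and Hq :: "real ^ 'n::_ \<Rightarrow> real ^ 'n::_ ^ 'n::_"
    and hi :: "'n \<Rightarrow> real \<Rightarrow> real"
    and \<omega> \<epsilon> \<eta> \<tau> L :: real
    and x0 :: "real ^ 'n::_"
    and x y d b :: "nat \<Rightarrow> real ^ 'n::_"
    and A :: "nat \<Rightarrow> real ^ 'n::_ ^ 'n::_"
    and \<Delta> \<alpha> \<delta> :: "nat \<Rightarrow> real"
  assumes q_convex: "convex_on UNIV q"
    and q_gradient: "\<And>z. GDERIV q z :> gq z"
    and q_hessian: "\<And>z. (gq has_derivative (\<lambda>v. Hq z *v v)) (at z)"
    and gradient_lipschitz: "L-lipschitz_on UNIV gq"
    and h_convex: "convex_on UNIV h"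
    and h_separable: "\<And>z. h z = (\<Sum>i\<in>UNIV. hi i (z $ i))"
    and f_eq: "\<And>z. f z = q z + h z"
    and f_bdd_below: "bdd_below (range f)"
    and \<omega>: "\<omega> \<in> {0<..<2}"
    and \<epsilon>: "\<epsilon> \<in> {0..}"
    and \<eta>: "\<eta> \<in> {0<..<1}"
    and \<tau>: "\<tau> \<in> {0<..<1}"
    and x_0: "x 0 = x0"
    and A: "\<And>k. A k = Hq (x k)"
    and b: "\<And>k. b k = gq (x k) - Hq (x k) *v x k"
    and y: "\<And>k. y k = triangle_prox \<omega> \<epsilon> (x k) (A k) (b k) h"
    and d: "\<And>k. d k = y k - x k"
    and \<Delta>: "\<And>k. \<Delta> k = gq (x k) \<bullet> d k + h (x k + d k) - h (x k)"
    and \<alpha>: "\<And>k. \<alpha> k = (GREATEST a. a \<in> range (\<lambda>j::nat. \<eta> ^ j) \<and>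
                          f (x k + a *\<^sub>R d k) \<le> f (x k) + a * \<tau> * \<Delta> k)"
    and x_Suc: "\<And>k. x (Suc k) = x k + \<alpha> k *\<^sub>R d k"
    and \<delta>: "\<And>k. \<delta> k = split_delta \<omega> \<epsilon> (A k)"
    and \<delta>_pos: "\<And>k. \<delta> k \<in> {0<..}"
  shows "(\<forall>k. \<alpha> k > 0 \<and> f (x k + \<alpha> k *\<^sub>R d k) \<le> f (x k) + \<alpha> k * \<tau> * \<Delta> k)
    \<and> decseq (\<lambda>k. f (x k))
    \<and> (\<forall>xs r. strict_mono r \<longrightarrow> (\<lambda>j. x (r j)) \<longlonglongrightarrow> xs
          \<longrightarrow> \<not> (\<lambda>j. \<delta> (r j)) \<longlonglongrightarrow> 0 \<longrightarrow> (\<forall>z. f xs \<le> f z))"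
proof -
  have L: "0 \<le> L" using gradient_lipschitz by (rule lipschitz_on_nonneg)
  have dpos: "0 < \<delta> k" for k using \<delta>_pos by simp
  have symm: "A k $ i $ j = A k $ j $ i" for k i j
    using hessian_symmetric[OF q_gradient q_hessian, where u = "axis j 1" and v = "axis i 1"]
    by (simp add: A inner_axis matrix_vector_mult_basis column_def)
  have psd: "0 \<le> v \<bullet> (A k *v v)" for k v
    using convex_hessian_nonneg[OF q_convex q_gradient q_hessian] by (simp add: A inner_commute)
  have coercive: "\<delta> k * (norm v)\<^sup>2 \<le> v \<bullet> (split_B \<omega> \<epsilon> (A k) *v v)" for k v
    unfolding \<delta> using \<omega> by (intro split_B_strongly_monotone symm psd) auto
  have sub: "- (split_B \<omega> \<epsilon> (A k) *v d k) - gq (x k) \<in> subdifferential h (x k + d k)" for k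
    using triangle_prox_step[OF symm psd _ _ _ h_convex, of \<omega> \<epsilon> k "x k" "gq (x k)"] \<omega> dpos[of k]
    by (simp add: y d b \<delta> A)
  have model: "\<Delta> k \<le> - (\<delta> k * (norm (d k))\<^sup>2)" for k
    unfolding \<Delta> by (rule model_decrease_le[OF sub coercive])
  \<comment> \<open>Steps of length at most \<open>1\<close> are sure to pass the descent test up to the length \<open>\<kappa> k / L\<close>.\<close>
  define \<kappa> where "\<kappa> k = 2 * (1 - \<tau>) * \<delta> k" for k
  have short: "f (x k + a *\<^sub>R d k) \<le> f (x k) + a * \<tau> * \<Delta> k"
    if "0 < a" "a \<le> 1" "L * a \<le> \<kappa> k" for k a
    using short_step_sufficient_decrease[OF q_gradient gradient_lipschitz h_convex,
        of "x k" "d k" "\<delta> k" a \<tau>] model[of k] that \<tau>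
    by (simp add: f_eq \<Delta> \<kappa>_def)
  have step: "f (x k + \<alpha> k *\<^sub>R d k) \<le> f (x k) + \<alpha> k * \<tau> * \<Delta> k"
    and step_ge: "min 1 (\<eta> * \<kappa> k / (L + 1)) \<le> \<alpha> k" for k
    using backtracking_step[of \<eta> L "\<kappa> k"
        "\<lambda>a. f (x k + a *\<^sub>R d k) \<le> f (x k) + a * \<tau> * \<Delta> k"] \<eta> \<tau> L dpos[of k] short
    by (auto simp: \<alpha> \<kappa>_def)
  have \<alpha>_pos: "0 < \<alpha> k" for k
  proof -
    have "0 < min 1 (\<eta> * \<kappa> k / (L + 1))" using \<eta> \<tau> L dpos[of k] by (simp add: \<kappa>_def)
    with step_ge[of k] show ?thesis by linarith
  qed
  have decrease: "\<alpha> k * (\<tau> * (\<delta> k * (norm (d k))\<^sup>2)) \<le> f (x k) - f (x (Suc k))" for k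
  proof -
    have "\<alpha> k * (\<tau> * (\<delta> k * (norm (d k))\<^sup>2)) \<le> \<alpha> k * (\<tau> * (- \<Delta> k))"
      using \<alpha>_pos[of k] \<tau> model[of k] by (intro mult_left_mono) auto
    with step[of k] show ?thesis by (simp add: x_Suc)
  qed
  have "f (x (Suc k)) \<le> f (x k)" for k
  proof -
    have "0 \<le> \<alpha> k * (\<tau> * (\<delta> k * (norm (d k))\<^sup>2))"
      using \<alpha>_pos[of k] \<tau> dpos[of k] by simp
    with decrease[of k] show ?thesis by linarith
  qed
  then have dec: "decseq (\<lambda>k. f (x k))" by (simp add: decseq_Suc_iff)
  have drop: "(\<lambda>k. f (x k) - f (x (Suc k))) \<longlonglongrightarrow> 0"
  proof -
    obtain m where "\<And>z. m \<le> f z" using f_bdd_below by (auto simp: bdd_below_def)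
    then obtain l where l: "(\<lambda>k. f (x k)) \<longlonglongrightarrow> l" using decseq_convergent[OF dec] by blast
    from tendsto_diff[OF l LIMSEQ_Suc[OF l]] show ?thesis by simp
  qed
  have "f xs \<le> f z" if r: "strict_mono r" and lim: "(\<lambda>j. x (r j)) \<longlonglongrightarrow> xs"
    and not0: "\<not> (\<lambda>j. \<delta> (r j)) \<longlonglongrightarrow> 0" for xs z and r :: "nat \<Rightarrow> nat"
  proof -
    obtain c and s :: "nat \<Rightarrow> nat" where "c > 0" and s: "strict_mono s" and c: "\<And>n. c \<le> \<bar>\<delta> (r (s n))\<bar>"
      using not_tendsto_0_subseq_bounded_away[OF not0] by metis
    define p where "p = r \<circ> s"
    have p: "strict_mono p" unfolding p_def using r s by (rule strict_mono_o)
    have c: "c \<le> \<delta> (p n)" for n using c[of n] dpos[of "p n"] by (simp add: p_def)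
    have xp: "(\<lambda>n. x (p n)) \<longlonglongrightarrow> xs"
      using LIMSEQ_subseq_LIMSEQ[OF lim s] by (simp add: p_def comp_def)
    \<comment> \<open>The bound from backtracking, made uniform along \<open>p\<close> by replacing \<open>\<delta>\<close> with \<open>c\<close>.\<close>
    define m where "m = min 1 (\<eta> * (2 * (1 - \<tau>) * c) / (L + 1))"
    have "m > 0" using \<eta> \<tau> L \<open>c > 0\<close> by (simp add: m_def)
    have m: "m \<le> \<alpha> (p n)" for n
    proof -
      have "m \<le> min 1 (\<eta> * \<kappa> (p n) / (L + 1))"
        unfolding m_def \<kappa>_def using \<eta> \<tau> L c[of n]
        by (intro min.mono order_refl divide_right_mono mult_left_mono) auto
      with step_ge[of "p n"] show ?thesis by linarith
    qed
    have bound: "m * (\<tau> * (c * (norm (d (p n)))\<^sup>2)) \<le> f (x (p n)) - f (x (Suc (p n)))" for n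
    proof -
      have "m * (\<tau> * (c * (norm (d (p n)))\<^sup>2)) \<le> \<alpha> (p n) * (\<tau> * (\<delta> (p n) * (norm (d (p n)))\<^sup>2))"
        using m[of n] c[of n] \<open>m > 0\<close> \<open>c > 0\<close> \<tau> by (intro mult_mono) auto
      with decrease[of "p n"] show ?thesis by linarith
    qed
    have "(\<lambda>n. m * (\<tau> * (c * (norm (d (p n)))\<^sup>2))) \<longlonglongrightarrow> 0"
    proof (rule tendsto_sandwich[OF _ _ tendsto_const])
      show "(\<lambda>n. f (x (p n)) - f (x (Suc (p n)))) \<longlonglongrightarrow> 0"
        using LIMSEQ_subseq_LIMSEQ[OF drop p] by (simp add: comp_def)
    qed (use bound \<open>m > 0\<close> \<open>c > 0\<close> \<tau> in auto)
    then have "(\<lambda>n. (1 / (m * \<tau> * c)) * (m * (\<tau> * (c * (norm (d (p n)))\<^sup>2)))) \<longlonglongrightarrow> 0"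
      by (rule tendsto_mult_right_zero)
    then have "(\<lambda>n. (norm (d (p n)))\<^sup>2) \<longlonglongrightarrow> 0"
      using \<open>m > 0\<close> \<open>c > 0\<close> \<tau> by simp
    then have norm_dp: "(\<lambda>n. norm (d (p n))) \<longlonglongrightarrow> 0" by simp
    then have dp: "(\<lambda>n. d (p n)) \<longlonglongrightarrow> 0" by (rule tendsto_norm_zero_cancel)
    define K where "K = (real CARD('n))\<^sup>2 * (L + L / \<omega> + \<epsilon>)"
    have "norm (split_B \<omega> \<epsilon> (A (p n)) *v d (p n)) \<le> norm (d (p n)) * K" for n
      using norm_split_B_mult_le[of "A (p n)" L \<omega> \<epsilon> "d (p n)"] \<omega> \<epsilon>
        lipschitz_derivative_norm_le[OF gradient_lipschitz q_hessian]
      by (simp add: A K_def mult.commute)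
    then have Bd: "(\<lambda>n. split_B \<omega> \<epsilon> (A (p n)) *v d (p n)) \<longlonglongrightarrow> 0"
      by (intro tendsto_0_le[OF dp, of _ K]) auto
    have "isCont gq xs" using q_hessian by (rule has_derivative_continuous)
    then have "(\<lambda>n. gq (x (p n))) \<longlonglongrightarrow> gq xs" using xp by (rule isCont_tendsto_compose)
    then have "(\<lambda>n. - (split_B \<omega> \<epsilon> (A (p n)) *v d (p n)) - gq (x (p n))) \<longlonglongrightarrow> - 0 - gq xs"
      by (intro tendsto_intros Bd)
    then have "- 0 - gq xs \<in> subdifferential h (xs + 0)"
      by (rule subdifferential_closed_graph[OF h_convex sub _ tendsto_add[OF xp dp]])
    then have "h xs - gq xs \<bullet> (z - xs) \<le> h z"
      by (simp add: subdifferential_def)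
    moreover have "q xs + gq xs \<bullet> (z - xs) \<le> q z"
      by (rule convex_gradient_inequality[OF q_convex q_gradient])
    ultimately show ?thesis by (simp add: f_eq)
  qed
  with step \<alpha>_pos dec show ?thesis by blast
qed

end
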